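(* The lower closed generalized Bregman distance associated with the operators $T=S=\log$ and the largest representative function $\sigma_{\log}$ of $\log$ is the function on $\mathbb{R}\times\mathbb{R}$ given by $$\overline{\mathcal{D}}_{\sigma_{\log}}(x,y)=\begin{cases} x\log(x)-x\log(y) & \text{if } 0<y\leq x,\\ 0 & \text{if } x=y=0,\\ \infty & \text{otherwise.}\end{cases}$$
   Context: $\log$ is the natural logarithm, regarded as a maximally monotone operator on $\mathbb{R}$ with domain $\left]0,\infty\right[$ and graph $\mathcal{G}(\log)=\{(z,\log z):z>0\}$. A function $h\colon\mathbb{R}\times\mathbb{R}\to\left]-\infty,+\infty\right]$ represents $\log$ (written $h\in\mathcal{H}(\log)$) if $h$ is convex and lower semicontinuous, $h(x,v)\geq xv$ for all $(x,v)$, and $h(x,v)=xv$ if and only if $(x,v)\in\mathcal{G}(\log)$. $\sigma_{\log}$ is the largest (pointwise) member of $\mathcal{H}(\log)$; it is known to exist, and its epigraph is the closed convex hull of the epigraph of the function equal to $xv$ on $\mathcal{G}(\log)$ and $+\infty$ elsewhere. The generalized Bregman distance is $\mathcal{D}_{\sigma_{\log}}(x,y):=\sigma_{\log}(x,\log y)-x\log y$ if $x>0$ and $y>0$, and $\mathcal{D}_{\sigma_{\log}}(x,y):=+\infty$ otherwise. Its lower closed version is its lower semicontinuous regularization $\overline{\mathcal{D}}_{\sigma_{\log}}(x,y):=\liminf_{(x',y')\to(x,y)}\mathcal{D}_{\sigma_{\log}}(x',y')$ (the liminf allows $(x',y')=(x,y)$), i.e., the function whose epigraph is the closure of $\operatorname{epi}\mathcal{D}_{\sigma_{\log}}$.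 *)

theory Defs
  imports "HOL-Analysis.Analysis"
begin

definition ereal_epigraph :: "('a \<Rightarrow> ereal) \<Rightarrow> ('a \<times> real) set"
  where "ereal_epigraph f = {(p, r). f p \<le> ereal r}"

definition ereal_convex :: "('a::real_vector \<Rightarrow> ereal) \<Rightarrow> bool"
  where "ereal_convex f \<longleftrightarrow> convex (ereal_epigraph f)"

text \<open>Since \<^term>\<open>nhds p\<close>, unlike \<^term>\<open>at p\<close>, does not exclude \<^term>\<open>p\<close> itself,
  the limes inferior below ranges over all points near \<^term>\<open>p\<close>, including \<^term>\<open>p\<close>.\<close>

definition lsc_regularization :: "('a::topological_space \<Rightarrow> ereal) \<Rightarrow> 'a \<Rightarrow> ereal"
  where "lsc_regularization f p = Liminf (nhds p) f"

definition lower_semicontinuous :: "('a::topological_space \<Rightarrow> ereal) \<Rightarrow> bool"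
  where "lower_semicontinuous f \<longleftrightarrow> (\<forall>p. f p \<le> Liminf (nhds p) f)"

text \<open>An operator on the real line is identified with its graph.\<close>

definition representatives :: "(real \<times> real) set \<Rightarrow> (real \<times> real \<Rightarrow> ereal) set"
  where "representatives T = {h.
    (\<forall>p. h p \<noteq> - \<infinity>) \<and> ereal_convex h \<and> lower_semicontinuous h \<and>
    (\<forall>x v. ereal (x * v) \<le> h (x, v)) \<and>
    (\<forall>x v. h (x, v) = ereal (x * v) \<longleftrightarrow> (x, v) \<in> T)}"

text \<open>The order on functions is pointwise, so this is the pointwise largest representative,
  whenever one exists.\<close>

definition largest_representative :: "(real \<times> real) set \<Rightarrow> real \<times> real \<Rightarrow> ereal"
  where "largest_representative T = (GREATEST h. h \<in> representatives T)"

definition log_graph :: "(real \<times> real) set"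
  where "log_graph = {(z, ln z) | z. 0 < z}"

definition sigma_log :: "real \<times> real \<Rightarrow> ereal"
  where "sigma_log = largest_representative log_graph"

text \<open>The generalized Bregman distance of a function \<^term>\<open>h\<close> representing the logarithm,
  both operators being the (single-valued) logarithm with domain the positive reals.\<close>

definition log_bregman :: "(real \<times> real \<Rightarrow> ereal) \<Rightarrow> real \<times> real \<Rightarrow> ereal"
  where "log_bregman h = (\<lambda>(x, y).
    if 0 < x \<and> 0 < y then h (x, ln y) - ereal (x * ln y) else \<infinity>)"

end

theory Submission
  imports Defs "HOL-Real_Asymp.Real_Asymp"
begin

text \<open>The function \<open>\<sigma>\<close> representing \<open>log\<close> is \<open>x ln x\<close> on the closed convex set \<open>exp v \<le> x\<close> and
  \<open>\<infinity>\<close> elsewhere. It is a representative because \<open>x ln x\<close> is convex. It is the largest one because a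
  point with \<open>exp v < x\<close> is the limit of convex combinations, with weight \<open>1/n\<close> on a point
  \<open>(z, ln z)\<close> where \<open>z\<close> decays exponentially in \<open>n\<close> and weight \<open>1 - 1/n\<close> on \<open>(x, ln x)\<close>:
  the first point moves the second coordinate by a fixed amount, but contributes nothing to
  the first coordinate and to the value in the limit.\<close>

section \<open>Bounds for the limes inferior over full neighbourhoods\<close>

lemma Liminf_nhds_le_sequence:
  fixes f :: "'a::topological_space \<Rightarrow> ereal"
  assumes X: "X \<longlonglongrightarrow> p" and b: "b \<longlonglongrightarrow> l" and le: "\<forall>\<^sub>F n in sequentially. f (X n) \<le> b n"
  shows "Liminf (nhds p) f \<le> l"
proof (rule dense_le)
  fix y assume "y < Liminf (nhds p) f"
  then have "\<forall>\<^sub>F q in nhds p. y < f q"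
    by (rule less_LiminfD)
  then have "\<forall>\<^sub>F n in sequentially. y < f (X n)"
    using X by (rule eventually_compose_filterlim)
  then have "\<forall>\<^sub>F n in sequentially. y \<le> b n"
    using le by eventually_elim auto
  with b show "y \<le> l"
    by (intro tendsto_lowerbound[OF b]) auto
qed

lemma Liminf_nhds_le:
  fixes f :: "'a::topological_space \<Rightarrow> ereal"
  shows "Liminf (nhds p) f \<le> f p"
  by (rule Liminf_nhds_le_sequence[of "\<lambda>_. p" _ "\<lambda>_. f p"]) auto

text \<open>Serves at points of finite value: when \<open>g\<close> also agrees with
  \<open>f\<close> at \<open>p\<close>, this is lower semicontinuity of \<open>f\<close> at
  \<open>p\<close>.\<close>

lemma Liminf_nhds_ge_continuous:
  fixes f :: "'a::t2_space \<Rightarrow> ereal" and g :: "'a \<Rightarrow> real"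
  assumes "isCont g p" and le: "\<And>q. ereal (g q) \<le> f q"
  shows "ereal (g p) \<le> Liminf (nhds p) f"
proof -
  have "(g \<longlongrightarrow> g p) (nhds p)"
    using assms(1) by (simp add: isCont_def tendsto_at_iff_tendsto_nhds)
  then have "Liminf (nhds p) (\<lambda>q. ereal (g q)) = ereal (g p)"
    by (intro lim_imp_Liminf) auto
  then show ?thesis
    using Liminf_mono[OF always_eventually, of "\<lambda>q. ereal (g q)" f "nhds p"] le by simp
qed

lemma Liminf_nhds_eq_infinity:
  fixes f :: "'a::topological_space \<Rightarrow> ereal"
  assumes "open U" "p \<in> U" "\<And>q. q \<in> U \<Longrightarrow> f q = \<infinity>"
  shows "Liminf (nhds p) f = \<infinity>"
proof -
  have "\<forall>\<^sub>F q in nhds p. f q = \<infinity>"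
    using assms by (auto simp: eventually_nhds)
  then have "(f \<longlongrightarrow> \<infinity>) (nhds p)"
    by (rule tendsto_eventually)
  then show ?thesis
    by (intro lim_imp_Liminf) auto
qed

section \<open>The candidate and its membership in the representatives of log\<close>

lemma convex_on_x_ln_x: "convex_on {0<..} (\<lambda>x::real. x * ln x)"
proof (rule f''_ge0_imp_convex[where f' = "\<lambda>x. ln x + 1" and f'' = "\<lambda>x. 1 / x"])
  show "((\<lambda>x. x * ln x) has_real_derivative ln x + 1) (at x)" if "x \<in> {0<..}" for x :: real
    using that by (auto intro!: derivative_eq_intros)
  show "((\<lambda>x. ln x + 1) has_real_derivative 1 / x) (at x)" if "x \<in> {0<..}" for x :: real
    using that by (auto intro!: derivative_eq_intros)
qed auto

text \<open>The single condition \<open>exp v \<le> x\<close> encodes \<open>v \<le> ln x\<close>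
  together with \<open>0 < x\<close>, so values of \<open>ln\<close> off the positive reals never
  enter.\<close>

definition x_ln_x_hull :: "real \<times> real \<Rightarrow> ereal"
  where "x_ln_x_hull = (\<lambda>(x, v). if exp v \<le> x then ereal (x * ln x) else \<infinity>)"

lemma ereal_epigraph_x_ln_x_hull:
  "ereal_epigraph x_ln_x_hull = {((x, v), r). exp v \<le> x \<and> x * ln x \<le> r}"
  by (auto simp: ereal_epigraph_def x_ln_x_hull_def split: if_splits)

text \<open>Two inequalities cut out the epigraph: \<open>x\<close> lies above the convex function
  \<open>exp\<close>, and \<open>r\<close> lies above \<open>x * ln x\<close>, which is convex
  because the first inequality forces \<open>0 < x\<close>.\<close>

lemma ereal_convex_x_ln_x_hull: "ereal_convex x_ln_x_hull"
  unfolding ereal_convex_def ereal_epigraph_x_ln_x_hull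
proof (rule convexI, clarsimp, intro conjI)
  fix x v r x' v' r' s t :: real
  assume st: "0 \<le> s" "0 \<le> t" "s + t = 1"
    and x: "exp v \<le> x" "x * ln x \<le> r" and x': "exp v' \<le> x'" "x' * ln x' \<le> r'"
  have "exp (s * v + t * v') \<le> s * exp v + t * exp v'"
    using st convex_onD[OF exp_convex, of t v v'] by (simp add: eq_diff_eq[symmetric])
  also have "\<dots> \<le> s * x + t * x'"
    using st x x' by (intro add_mono mult_left_mono) auto
  finally show "exp (s * v + t * v') \<le> s * x + t * x'" .
  have "0 < x" "0 < x'"
    using x x' exp_gt_zero less_le_trans by blast+
  then have "(s * x + t * x') * ln (s * x + t * x') \<le> s * (x * ln x) + t * (x' * ln x')"
    using convex_onD[OF convex_on_x_ln_x, of t x x'] st by (simp add: eq_diff_eq[symmetric])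
  also have "\<dots> \<le> s * r + t * r'"
    using st x x' by (intro add_mono mult_left_mono) auto
  finally show "(s * x + t * x') * ln (s * x + t * x') \<le> s * r + t * r'" .
qed

text \<open>The domain is closed, so the value is infinite near each point outside it. At a point of
  the domain, \<open>x * ln x\<close> is a continuous minorant with equality.\<close>

lemma lower_semicontinuous_x_ln_x_hull: "lower_semicontinuous x_ln_x_hull"
  unfolding lower_semicontinuous_def
proof clarify
  fix x v :: real
  show "x_ln_x_hull (x, v) \<le> Liminf (nhds (x, v)) x_ln_x_hull"
  proof (cases "exp v \<le> x")
    case True
    then have "0 < x"
      using exp_gt_zero less_le_trans by blast
    then have "ereal ((\<lambda>q. fst q * ln (fst q)) (x, v)) \<le> Liminf (nhds (x, v)) x_ln_x_hull"
      by (intro Liminf_nhds_ge_continuous continuous_intros)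
        (auto simp: x_ln_x_hull_def)
    with True show ?thesis
      by (simp add: x_ln_x_hull_def)
  next
    case False
    have "open {q :: real \<times> real. fst q < exp (snd q)}"
      by (intro open_Collect_less continuous_intros)
    then have "Liminf (nhds (x, v)) x_ln_x_hull = \<infinity>"
      using False by (elim Liminf_nhds_eq_infinity) (auto simp: x_ln_x_hull_def)
    then show ?thesis
      by simp
  qed
qed

text \<open>On the domain the excess over \<open>x * v\<close> is \<open>x * (ln x - v)\<close>, a
  product of a positive and a nonnegative factor that vanishes only for
  \<open>v = ln x\<close>.\<close>

lemma x_ln_x_hull_representative: "x_ln_x_hull \<in> representatives log_graph"
proof -
  have *: "v \<le> ln x" "0 < x" if "exp v \<le> x" for x v :: real
    using that less_le_trans[OF exp_gt_zero[of v]] by (auto simp: ln_ge_iff)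
  have "x_ln_x_hull p \<noteq> - \<infinity>" for p
    by (simp add: x_ln_x_hull_def split: prod.split)
  moreover have "ereal (x * v) \<le> x_ln_x_hull (x, v)" for x v
    using * by (auto simp: x_ln_x_hull_def)
  moreover have "x_ln_x_hull (x, v) = ereal (x * v) \<longleftrightarrow> (x, v) \<in> log_graph" for x v
    using * by (auto simp: x_ln_x_hull_def log_graph_def)
  ultimately show ?thesis
    using ereal_convex_x_ln_x_hull lower_semicontinuous_x_ln_x_hull
    by (simp add: representatives_def)
qed

section \<open>Maximality of the candidate\<close>

lemma representative_le_x_ln_x_hull:
  assumes h: "h \<in> representatives log_graph"
  shows "h (x, v) \<le> x_ln_x_hull (x, v)"
proof (cases "exp v < x")
  case True
  then have x: "0 < x"
    using exp_gt_zero less_trans by blast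
  define c where "c = ln x - v"
  have c: "0 < c"
    using True x by (simp add: c_def exp_less_cancel_iff flip: exp_less_cancel_iff[of v])
  have graph: "((z, ln z), z * ln z) \<in> ereal_epigraph h" if "0 < z" for z
  proof -
    have "h (z, ln z) = ereal (z * ln z)"
      using h that by (simp add: representatives_def log_graph_def)
    then show ?thesis
      by (simp add: ereal_epigraph_def)
  qed
  have conv: "convex (ereal_epigraph h)" and lsc: "h (x, v) \<le> Liminf (nhds (x, v)) h"
    using h by (auto simp: representatives_def ereal_convex_def lower_semicontinuous_def)
  \<comment> \<open>Since \<open>ln (z n) = ln x - c * n\<close>, weight \<open>1 / n\<close> on
    this point lowers the second coordinate from \<open>ln x\<close> to exactly
    \<open>v\<close>.\<close>
  define z where "z n = x * exp (- c * real n)" for n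
  define X where "X n = (1 / real n * z n + (1 - 1 / real n) * x, v)" for n
  define b where "b n = 1 / real n * (z n * ln (z n)) + (1 - 1 / real n) * (x * ln x)" for n
  \<comment> \<open>At \<open>n = 0\<close> the convention \<open>1 / 0 = 0\<close> would turn this
    inequality into the bound being proved.\<close>
  have le: "h (X n) \<le> ereal (b n)" if n: "0 < n" for n
  proof -
    have ln_z: "ln (z n) = ln x - c * real n" and z: "0 < z n"
      using x by (simp_all add: z_def ln_mult)
    have "(1 / real n) *\<^sub>R ((z n, ln (z n)), z n * ln (z n))
        + (1 - 1 / real n) *\<^sub>R ((x, ln x), x * ln x) \<in> ereal_epigraph h"
      using n x z by (intro convexD[OF conv] graph) auto
    also have "(1 / real n) *\<^sub>R ((z n, ln (z n)), z n * ln (z n))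
        + (1 - 1 / real n) *\<^sub>R ((x, ln x), x * ln x) = (X n, b n)"
      using n by (simp add: X_def b_def ln_z c_def field_simps)
    finally show ?thesis
      by (simp add: ereal_epigraph_def)
  qed
  have "X \<longlonglongrightarrow> (x, v)"
    unfolding X_def z_def using c by (intro tendsto_Pair tendsto_const) real_asymp
  moreover have "b \<longlonglongrightarrow> x * ln x"
    unfolding b_def z_def using c x by real_asymp
  ultimately have "Liminf (nhds (x, v)) h \<le> ereal (x * ln x)"
    using le by (intro Liminf_nhds_le_sequence[where b = "\<lambda>n. ereal (b n)"])
      (auto intro: eventually_sequentiallyI[of 1])
  with lsc True show ?thesis
    by (simp add: x_ln_x_hull_def)
next
  case False
  \<comment> \<open>Either \<open>x < exp v\<close>, where the bound is infinite, or
    \<open>x = exp v\<close>, a point of the graph, where \<open>h\<close> is prescribed.\<close>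
  have "h (exp v, v) = ereal (exp v * v)"
    using h by (force simp: representatives_def log_graph_def)
  with False show ?thesis
    by (auto simp: x_ln_x_hull_def)
qed

lemma sigma_log_eq: "sigma_log = x_ln_x_hull"
  unfolding sigma_log_def largest_representative_def
  using x_ln_x_hull_representative representative_le_x_ln_x_hull
  by (intro Greatest_equality) (auto simp: le_fun_def)

section \<open>Lower closure of the Bregman distance\<close>

lemma log_bregman_sigma_log:
  "log_bregman sigma_log (x, y) = (if 0 < y \<and> y \<le> x then ereal (x * ln x - x * ln y) else \<infinity>)"
  by (auto simp: log_bregman_def sigma_log_eq x_ln_x_hull_def)

text \<open>The distance is nonnegative because \<open>ln\<close> is increasing, and it vanishes on
  the positive diagonal, which tends to the origin.\<close>

lemma Liminf_log_bregman_zero: "Liminf (nhds (0, 0)) (log_bregman sigma_log) = 0"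
proof (rule antisym)
  have "0 \<le> log_bregman sigma_log (x, y)" for x y
    by (auto simp: log_bregman_sigma_log mult_left_mono)
  then show "0 \<le> Liminf (nhds (0, 0)) (log_bregman sigma_log)"
    by (intro Liminf_bounded always_eventually) auto
  have "(\<lambda>n. (1 / real (Suc n), 1 / real (Suc n))) \<longlonglongrightarrow> (0, 0)"
    by (intro tendsto_Pair LIMSEQ_Suc lim_1_over_n)
  then show "Liminf (nhds (0, 0)) (log_bregman sigma_log) \<le> 0"
    by (rule Liminf_nhds_le_sequence[where b = "\<lambda>_. 0"]) (auto simp: log_bregman_sigma_log)
qed

text \<open>As \<open>y\<close> decreases to 0, \<open>- ln y\<close> blows up, and its factor, the
  first coordinate, stays bounded away from 0 near \<open>x\<close>.\<close>

lemma Liminf_log_bregman_boundary: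
  assumes x: "0 < x"
  shows "Liminf (nhds (x, 0)) (log_bregman sigma_log) = \<infinity>"
proof (rule ereal_top)
  fix M :: real
  \<comment> \<open>On \<open>U\<close> with positive second coordinate, the logarithms differ by at
    least \<open>K\<close> and the factor exceeds \<open>x / 2\<close>, so the product is at least
    \<open>x / 2 * K = \<bar>M\<bar>\<close>. The absolute value keeps \<open>K\<close> nonnegative,
    as multiplying the two bounds requires.\<close>
  define K where "K = 2 * \<bar>M\<bar> / x"
  define U where "U = {x / 2<..} \<times> {..<x / 2 * exp (- K)}"
  have K: "0 \<le> K"
    using x by (simp add: K_def)
  have "ereal M \<le> log_bregman sigma_log q" if "q \<in> U" for q
  proof (cases q)
    case (Pair x' y)
    have "M \<le> x' * ln x' - x' * ln y" if y: "0 < y"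
    proof -
      have x': "x / 2 < x'" and "y < x / 2 * exp (- K)"
        using \<open>q \<in> U\<close> Pair by (auto simp: U_def)
      then have "ln y \<le> ln (x / 2 * exp (- K))"
        using y by simp
      also have "\<dots> = ln (x / 2) - K"
        using x by (subst ln_mult) auto
      also have "\<dots> \<le> ln x' - K"
        using x x' by simp
      finally have "K \<le> ln x' - ln y"
        by simp
      then have "x / 2 * K \<le> x' * (ln x' - ln y)"
        using x x' K by (intro mult_mono) auto
      moreover have "x / 2 * K = \<bar>M\<bar>"
        using x by (simp add: K_def)
      ultimately show ?thesis
        by (simp add: algebra_simps)
    qed
    then show ?thesis
      by (simp add: Pair log_bregman_sigma_log)
  qed
  moreover have "open U" "(x, 0) \<in> U"
    using x by (auto simp: U_def intro: open_Times)
  ultimately show "ereal M \<le> Liminf (nhds (x, 0)) (log_bregman sigma_log)"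
    by (intro Liminf_bounded) (auto simp: eventually_nhds)
qed

theorem corollary3p6:
  fixes x y :: real
  shows "lsc_regularization (log_bregman sigma_log) (x, y) =
    (if 0 < y \<and> y \<le> x then ereal (x * ln x - x * ln y)
     else if x = 0 \<and> y = 0 then 0
     else \<infinity>)"
proof -
  let ?D = "log_bregman sigma_log"
  \<comment> \<open>Relative to the wedge \<open>0 < y \<le> x\<close>, the point lies in it, at its
    apex, on its missing edge, or in the open complement of its closure, where the distance is
    infinite.\<close>
  consider "0 < y" "y \<le> x" | "x = 0" "y = 0" | "0 < x" "y = 0" | "y < 0 \<or> x < y"
    by linarith
  then have "Liminf (nhds (x, y)) ?D = (if 0 < y \<and> y \<le> x then ereal (x * ln x - x * ln y)
     else if x = 0 \<and> y = 0 then 0 else \<infinity>)"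
  proof cases
    case 1
    let ?g = "\<lambda>q. fst q * ln (fst q) - fst q * ln (snd q)"
    have "isCont ?g (x, y)"
      using 1 by (intro continuous_intros) auto
    then have "ereal (?g (x, y)) \<le> Liminf (nhds (x, y)) ?D"
      by (rule Liminf_nhds_ge_continuous) (auto simp: log_bregman_sigma_log)
    with Liminf_nhds_le[of "(x, y)" ?D] 1 show ?thesis
      by (simp add: log_bregman_sigma_log)
  next
    case 2
    then show ?thesis
      by (simp add: Liminf_log_bregman_zero)
  next
    case 3
    then show ?thesis
      by (simp add: Liminf_log_bregman_boundary)
  next
    case 4
    have "open {q :: real \<times> real. snd q < 0 \<or> fst q < snd q}"
      by (intro open_Collect_disj open_Collect_less continuous_intros)
    then have "Liminf (nhds (x, y)) ?D = \<infinity>"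
      using 4 by (elim Liminf_nhds_eq_infinity) (auto simp: log_bregman_sigma_log)
    with 4 show ?thesis
      by auto
  qed
  then show ?thesis
    by (simp add: lsc_regularization_def)
qed

end
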